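(* Let $(a_i)_{i=1}^m$ and $(b_j)_{j=1}^n$ be two families of positive integers. Let $A=\bigoplus_{i=1}^m\mathbb{Z}_{a_i}$ and $B=\bigoplus_{j=1}^n\mathbb{Z}_{b_j}$. Then $$A\otimes B\cong\bigoplus_{\substack{i=1,\dots,m\\ j=1,\dots,n}}\mathbb{Z}_{(a_i,b_j)},$$ where the isomorphism is given by the unique group homomorphism such that $$(x_1\bmod a_1,\dots,x_m\bmod a_m)\otimes(y_1\bmod b_1,\dots,y_n\bmod b_n)\mapsto\big((x_iy_j)\bmod(a_i,b_j)\big)_{\substack{i=1,\dots,m\\ j=1,\dots,n}}.$$ Moreover, under this identification, the canonical bilinear map is given by $\otimes\colon A\times B\rightarrow\bigoplus_{i,j}\mathbb{Z}_{(a_i,b_j)}$ with $$(x_1\bmod a_1,\dots,x_m\bmod a_m)\otimes(y_1\bmod b_1,\dots,y_n\bmod b_n)=\big((x_iy_j)\bmod(a_i,b_j)\big)_{\substack{i=1,\dots,m\\ j=1,\dots,n}}.$$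
   Context: $(a,b)$ denotes the greatest common divisor of the positive integers $a$ and $b$, and $\mathbb{Z}_a$ the cyclic group of integers modulo $a$. $A\otimes B$ is the tensor product $A\otimes_{\mathbb{Z}}B$ of abelian groups, and the canonical bilinear map $A\times B\to A\otimes B$ sends a pair to the corresponding elementary tensor. *)

theory Defs
  imports "HOL-Algebra.Algebra"
begin

text \<open>Abelian groups are written multiplicatively, as everywhere in the group library used here.\<close>

definition bilinear_map ::
  "('a, 'm) monoid_scheme \<Rightarrow> ('b, 'n) monoid_scheme \<Rightarrow> ('c, 'k) monoid_scheme \<Rightarrow> ('a \<Rightarrow> 'b \<Rightarrow> 'c) \<Rightarrow> bool"
  where "bilinear_map A B C f \<longleftrightarrow>
    (\<forall>x\<in>carrier A. \<forall>y\<in>carrier B. f x y \<in> carrier C) \<and>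
    (\<forall>x\<in>carrier A. \<forall>x'\<in>carrier A. \<forall>y\<in>carrier B.
      f (x \<otimes>\<^bsub>A\<^esub> x') y = f x y \<otimes>\<^bsub>C\<^esub> f x' y) \<and>
    (\<forall>x\<in>carrier A. \<forall>y\<in>carrier B. \<forall>y'\<in>carrier B.
      f x (y \<otimes>\<^bsub>B\<^esub> y') = f x y \<otimes>\<^bsub>C\<^esub> f x y')"

text \<open>The tensor product over the integers: the free abelian group on the pairs, modulo the
  subgroup generated by the relations that make \<^term>\<open>Pair\<close> bilinear.  The free abelian group
  is realised by finitely supported integer-valued functions, whence the additive notation.\<close>

definition tensor_rels ::
  "('a, 'm) monoid_scheme \<Rightarrow> ('b, 'n) monoid_scheme \<Rightarrow> ('a \<times> 'b \<Rightarrow>\<^sub>0 int) set"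
  where "tensor_rels A B =
    {frag_of (x \<otimes>\<^bsub>A\<^esub> x', y) - frag_of (x, y) - frag_of (x', y) | x x' y.
       x \<in> carrier A \<and> x' \<in> carrier A \<and> y \<in> carrier B} \<union>
    {frag_of (x, y \<otimes>\<^bsub>B\<^esub> y') - frag_of (x, y) - frag_of (x, y') | x y y'.
       x \<in> carrier A \<and> y \<in> carrier B \<and> y' \<in> carrier B}"

definition tensor_kernel ::
  "('a, 'm) monoid_scheme \<Rightarrow> ('b, 'n) monoid_scheme \<Rightarrow> ('a \<times> 'b \<Rightarrow>\<^sub>0 int) set"
  where "tensor_kernel A B =
    generate (free_Abelian_group (carrier A \<times> carrier B)) (tensor_rels A B)"

definition tensor_group ::
  "('a, 'm) monoid_scheme \<Rightarrow> ('b, 'n) monoid_scheme \<Rightarrow> ('a \<times> 'b \<Rightarrow>\<^sub>0 int) set monoid"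
  where "tensor_group A B =
    free_Abelian_group (carrier A \<times> carrier B) Mod tensor_kernel A B"

definition elem_tensor ::
  "('a, 'm) monoid_scheme \<Rightarrow> ('b, 'n) monoid_scheme \<Rightarrow> 'a \<Rightarrow> 'b \<Rightarrow> ('a \<times> 'b \<Rightarrow>\<^sub>0 int) set"
  where "elem_tensor A B x y =
    tensor_kernel A B #>\<^bsub>free_Abelian_group (carrier A \<times> carrier B)\<^esub> frag_of (x, y)"

definition cyclic_sum :: "'i set \<Rightarrow> ('i \<Rightarrow> nat) \<Rightarrow> ('i \<Rightarrow> int) monoid"
  where "cyclic_sum I c = sum_group I (\<lambda>i. integer_mod_group (c i))"

text \<open>The family of residue classes of the integers \<open>x i\<close>.  Elements of
  \<^term>\<open>integer_mod_group k\<close> for \<open>k > 0\<close> are the least nonnegative residues, so the class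
  of an integer is its value under \<^term>\<open>(mod)\<close>.\<close>

definition residue_family :: "'i set \<Rightarrow> ('i \<Rightarrow> nat) \<Rightarrow> ('i \<Rightarrow> int) \<Rightarrow> 'i \<Rightarrow> int"
  where "residue_family I c x = (\<lambda>i\<in>I. x i mod int (c i))"

text \<open>The facts below confirm that this is the tensor product: \<^const>\<open>elem_tensor\<close> is a
  universal bilinear map, and residue families are exactly the elements of the direct sum.\<close>

lemma residue_family_surj:
  assumes "finite I" "\<And>i. i \<in> I \<Longrightarrow> c i > 0"
  shows "range (residue_family I c) = carrier (cyclic_sum I c)"
proof
  show "range (residue_family I c) \<subseteq> carrier (cyclic_sum I c)"
    using assms
    by (auto simp: residue_family_def cyclic_sum_def carrier_sum_group carrier_integer_mod_group)
  show "carrier (cyclic_sum I c) \<subseteq> range (residue_family I c)"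
  proof
    fix u assume u: "u \<in> carrier (cyclic_sum I c)"
    have "residue_family I c u = u"
    proof
      fix i show "residue_family I c u i = u i"
      proof (cases "i \<in> I")
        case True
        with u assms(2) [of i] have "0 \<le> u i \<and> u i < int (c i)"
          by (auto simp: cyclic_sum_def carrier_sum_group carrier_integer_mod_group PiE_iff
              dest!: bspec [where x = i])
        with True show ?thesis by (simp add: residue_family_def)
      next
        case False
        with u show ?thesis
          by (auto simp: cyclic_sum_def carrier_sum_group residue_family_def PiE_iff extensional_def)
      qed
    qed
    then show "u \<in> range (residue_family I c)" by (metis rangeI)
  qed
qed

lemma tensor_rels_subset:
  assumes "monoid A" "monoid B"
  shows "tensor_rels A B \<subseteq> carrier (free_Abelian_group (carrier A \<times> carrier B))"
proof -
  let ?F = "free_Abelian_group (carrier A \<times> carrier B)"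
  have diff: "p - q - r \<in> carrier ?F"
    if "p \<in> carrier ?F" "q \<in> carrier ?F" "r \<in> carrier ?F" for p q r
    using that keys_diff [of p q] keys_diff [of "p - q" r]
    unfolding carrier_free_Abelian_group_iff by blast
  show ?thesis
    unfolding tensor_rels_def using assms
    by (auto simp del: carrier_free_Abelian_group_iff
        simp: frag_of_in_free_Abelian_group monoid.m_closed intro!: diff)
qed

lemma tensor_kernel_normal:
  assumes "monoid A" "monoid B"
  shows "tensor_kernel A B \<lhd> free_Abelian_group (carrier A \<times> carrier B)"
proof -
  interpret F: comm_group "free_Abelian_group (carrier A \<times> carrier B)"
    by (rule abelian_free_Abelian_group)
  show ?thesis
    unfolding tensor_kernel_def
    by (intro F.subgroup_imp_normal F.generate_is_subgroup tensor_rels_subset assms)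
qed

lemma comm_group_tensor_group:
  assumes "monoid A" "monoid B"
  shows "comm_group (tensor_group A B)"
proof -
  interpret F: comm_group "free_Abelian_group (carrier A \<times> carrier B)"
    by (rule abelian_free_Abelian_group)
  show ?thesis
    unfolding tensor_group_def
    by (intro F.abelian_FactGroup normal_imp_subgroup tensor_kernel_normal assms)
qed

lemma bilinear_elem_tensor:
  assumes "monoid A" "monoid B"
  shows "bilinear_map A B (tensor_group A B) (elem_tensor A B)"
proof -
  let ?F = "free_Abelian_group (carrier A \<times> carrier B)"
  let ?K = "tensor_kernel A B"
  interpret F: comm_group ?F by (rule abelian_free_Abelian_group)
  interpret N: normal ?K ?F by (rule tensor_kernel_normal [OF assms])
  have eq: "?K #>\<^bsub>?F\<^esub> p = (?K #>\<^bsub>?F\<^esub> q) <#>\<^bsub>?F\<^esub> (?K #>\<^bsub>?F\<^esub> r)"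
    if "p - q - r \<in> tensor_rels A B" "p \<in> carrier ?F" "q \<in> carrier ?F" "r \<in> carrier ?F"
    for p q r
  proof -
    have qr: "q + r \<in> carrier ?F"
      using F.m_closed [OF that(3,4)] by simp
    have "p - q - r \<in> ?K"
      using that(1) unfolding tensor_kernel_def by (rule generate.incl)
    then have "p \<in> ?K #>\<^bsub>?F\<^esub> (q + r)"
      unfolding r_coset_def by (force simp: algebra_simps)
    then have "?K #>\<^bsub>?F\<^esub> p = ?K #>\<^bsub>?F\<^esub> (q + r)"
      using F.repr_independence [OF _ qr N.subgroup_axioms] by metis
    also have "\<dots> = (?K #>\<^bsub>?F\<^esub> q) <#>\<^bsub>?F\<^esub> (?K #>\<^bsub>?F\<^esub> r)"
      using N.rcos_sum [OF that(3,4)] by simp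
    finally show ?thesis .
  qed
  have cl: "frag_of (x, y) \<in> carrier ?F" if "x \<in> carrier A" "y \<in> carrier B" for x y
    using that by simp
  show ?thesis
    unfolding bilinear_map_def
  proof (intro conjI ballI)
    fix x y assume "x \<in> carrier A" "y \<in> carrier B"
    then show "elem_tensor A B x y \<in> carrier (tensor_group A B)"
      unfolding elem_tensor_def tensor_group_def carrier_FactGroup by (blast intro: cl)
  next
    fix x x' y assume h: "x \<in> carrier A" "x' \<in> carrier A" "y \<in> carrier B"
    then have "frag_of (x \<otimes>\<^bsub>A\<^esub> x', y) - frag_of (x, y) - frag_of (x', y) \<in> tensor_rels A B"
      unfolding tensor_rels_def by blast
    from eq [OF this] h assms(1)
    show "elem_tensor A B (x \<otimes>\<^bsub>A\<^esub> x') y =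
        elem_tensor A B x y \<otimes>\<^bsub>tensor_group A B\<^esub> elem_tensor A B x' y"
      by (simp add: elem_tensor_def tensor_group_def monoid.m_closed)
  next
    fix x y y' assume h: "x \<in> carrier A" "y \<in> carrier B" "y' \<in> carrier B"
    then have "frag_of (x, y \<otimes>\<^bsub>B\<^esub> y') - frag_of (x, y) - frag_of (x, y') \<in> tensor_rels A B"
      unfolding tensor_rels_def by blast
    from eq [OF this] h assms(2)
    show "elem_tensor A B x (y \<otimes>\<^bsub>B\<^esub> y') =
        elem_tensor A B x y \<otimes>\<^bsub>tensor_group A B\<^esub> elem_tensor A B x y'"
      by (simp add: elem_tensor_def tensor_group_def monoid.m_closed)
  qed
qed

lemma tensor_group_universal:
  assumes "monoid A" "monoid B" "comm_group C" "bilinear_map A B C f"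
  obtains g where "g \<in> hom (tensor_group A B) C"
    "\<And>x y. \<lbrakk>x \<in> carrier A; y \<in> carrier B\<rbrakk> \<Longrightarrow> g (elem_tensor A B x y) = f x y"
proof -
  let ?F = "free_Abelian_group (carrier A \<times> carrier B)"
  interpret C: comm_group C by fact
  interpret F: comm_group ?F by (rule abelian_free_Abelian_group)
  have "case_prod f ` (carrier A \<times> carrier B) \<subseteq> carrier C"
    using assms(4) by (auto simp: bilinear_map_def)
  then obtain h where h: "h \<in> hom ?F C"
    and hf: "\<And>z. z \<in> carrier A \<times> carrier B \<Longrightarrow> h (frag_of z) = case_prod f z"
    using C.free_Abelian_group_universal by blast
  interpret h: group_hom ?F C h
    by (simp add: group_hom_def group_hom_axioms_def h C.is_group)
  have ker: "p - q - r \<in> kernel ?F C h"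
    if "p \<in> carrier ?F" "q \<in> carrier ?F" "r \<in> carrier ?F" "h p = h q \<otimes>\<^bsub>C\<^esub> h r" for p q r
  proof -
    have e: "p - q - r = p \<otimes>\<^bsub>?F\<^esub> inv\<^bsub>?F\<^esub> (q \<otimes>\<^bsub>?F\<^esub> r)"
      using F.m_closed [OF that(2,3)] by (simp add: algebra_simps)
    have "h (p \<otimes>\<^bsub>?F\<^esub> inv\<^bsub>?F\<^esub> (q \<otimes>\<^bsub>?F\<^esub> r)) = h p \<otimes>\<^bsub>C\<^esub> inv\<^bsub>C\<^esub> (h q \<otimes>\<^bsub>C\<^esub> h r)"
      using that F.m_closed [OF that(2,3)] F.inv_closed
      by (simp only: h.hom_mult h.hom_inv F.inv_closed)
    also have "\<dots> = \<one>\<^bsub>C\<^esub>"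
      using that by (simp add: C.r_inv del: carrier_free_Abelian_group_iff)
    finally show ?thesis
      unfolding e kernel_def
      using that by (simp del: carrier_free_Abelian_group_iff mult_free_Abelian_group inv_free_Abelian_group)
  qed
  have "tensor_rels A B \<subseteq> kernel ?F C h"
    unfolding tensor_rels_def using assms
    by (auto intro!: ker simp: hf monoid.m_closed bilinear_map_def)
  then have "tensor_kernel A B \<subseteq> kernel ?F C h"
    unfolding tensor_kernel_def
    by (intro F.generate_subgroup_incl h.subgroup_kernel)
  from h.FactGroup_universal_kernel [OF tensor_kernel_normal [OF assms(1,2)] this]
  obtain g where g: "g \<in> hom (?F Mod tensor_kernel A B) C"
    "\<And>z. z \<in> carrier ?F \<Longrightarrow> g (tensor_kernel A B #>\<^bsub>?F\<^esub> z) = h z" by blast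
  show thesis
    by (rule that [of g]) (use g hf in \<open>auto simp: tensor_group_def elem_tensor_def\<close>)
qed

lemma tensor_group_hom_unique:
  assumes "monoid A" "monoid B" "group C"
    and g: "g \<in> hom (tensor_group A B) C" and g': "g' \<in> hom (tensor_group A B) C"
    and eq: "\<And>x y. \<lbrakk>x \<in> carrier A; y \<in> carrier B\<rbrakk> \<Longrightarrow>
               g (elem_tensor A B x y) = g' (elem_tensor A B x y)"
    and t: "t \<in> carrier (tensor_group A B)"
  shows "g t = g' t"
proof -
  let ?F = "free_Abelian_group (carrier A \<times> carrier B)"
  let ?K = "tensor_kernel A B"
  let ?q = "\<lambda>z. ?K #>\<^bsub>?F\<^esub> z"
  interpret F: comm_group ?F by (rule abelian_free_Abelian_group)
  interpret N: normal ?K ?F by (rule tensor_kernel_normal [OF assms(1,2)])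
  interpret C: group C by fact
  have q: "?q \<in> hom ?F (tensor_group A B)"
    unfolding tensor_group_def by (rule N.r_coset_hom_Mod)
  interpret u: group_hom ?F C "g \<circ> ?q"
    by (simp add: group_hom_def group_hom_axioms_def C.is_group hom_compose [OF q g])
  interpret v: group_hom ?F C "g' \<circ> ?q"
    by (simp add: group_hom_def group_hom_axioms_def C.is_group hom_compose [OF q g'])
  have "(g \<circ> ?q) z = (g' \<circ> ?q) z" if "Poly_Mapping.keys z \<subseteq> carrier A \<times> carrier B" for z
  proof (rule free_Abelian_group_induct [OF that])
    show "(g \<circ> ?q) 0 = (g' \<circ> ?q) 0" using u.hom_one v.hom_one by simp
  next
    fix z w
    assume "Poly_Mapping.keys z \<subseteq> carrier A \<times> carrier B" "Poly_Mapping.keys w \<subseteq> carrier A \<times> carrier B"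
      and ih: "(g \<circ> ?q) z = (g' \<circ> ?q) z" "(g \<circ> ?q) w = (g' \<circ> ?q) w"
    then have zw: "z \<in> carrier ?F" "w \<in> carrier ?F" by simp_all
    have e: "z - w = z \<otimes>\<^bsub>?F\<^esub> inv\<^bsub>?F\<^esub> w" using zw by simp
    show "(g \<circ> ?q) (z - w) = (g' \<circ> ?q) (z - w)"
      unfolding e using ih zw
      by (simp only: u.hom_mult v.hom_mult u.hom_inv v.hom_inv F.inv_closed)
  next
    fix z assume "z \<in> carrier A \<times> carrier B"
    then show "(g \<circ> ?q) (frag_of z) = (g' \<circ> ?q) (frag_of z)"
      using eq by (cases z) (auto simp: elem_tensor_def)
  qed
  moreover from t obtain z where "z \<in> carrier ?F" "t = ?q z"
    unfolding tensor_group_def carrier_FactGroup by blast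
  ultimately show ?thesis by simp
qed

end

theory Submission
  imports Defs
begin

text \<open>A homomorphism out of a direct sum of cyclic groups is determined by the images of the
  basis elements, which may be prescribed freely subject to the order of each image dividing the
  order of its summand.  Since \<open>e\<^sub>i \<otimes> f\<^sub>j\<close> is killed by both \<open>a\<^sub>i\<close> and \<open>b\<^sub>j\<close>, hence by their greatest
  common divisor, the assignment of \<open>e\<^sub>i \<otimes> f\<^sub>j\<close> to the basis element of index \<open>(i, j)\<close> extends to a
  homomorphism from the direct sum to the tensor product.  It inverts the map induced by the
  bilinear map of coordinatewise products, because both composites fix the basis elements.\<close>

section \<open>Residue families and basis elements of a direct sum of cyclic groups\<close>

text \<open>Wrapping the indicator of \<open>k\<close> in \<open>residue_family\<close> gives the
  group's own encoding: the entry 1 is reduced, so the element is trivial when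
  \<open>c k = 1\<close>, and values off \<open>I\<close> are \<open>undefined\<close>.\<close>

definition cyclic_basis :: "'i set \<Rightarrow> ('i \<Rightarrow> nat) \<Rightarrow> 'i \<Rightarrow> 'i \<Rightarrow> int"
  where "cyclic_basis I c k = residue_family I c (\<lambda>i. of_bool (i = k))"

lemma comm_group_cyclic_sum: "comm_group (cyclic_sum I c)"
  unfolding cyclic_sum_def
  by (rule group.group_comm_groupI) (auto simp: add.commute)

lemma group_cyclic_sum: "group (cyclic_sum I c)"
  by (rule comm_group.axioms(2) [OF comm_group_cyclic_sum])

lemma monoid_cyclic_sum: "monoid (cyclic_sum I c)"
  by (rule group.is_monoid [OF group_cyclic_sum])

lemma residue_family_cong:
  "(\<And>i. i \<in> I \<Longrightarrow> x i mod int (c i) = y i mod int (c i)) \<Longrightarrow> residue_family I c x = residue_family I c y"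
  by (auto simp: residue_family_def)

lemma residue_family_mult:
  "residue_family I c x \<otimes>\<^bsub>cyclic_sum I c\<^esub> residue_family I c y = residue_family I c (\<lambda>i. x i + y i)"
  by (auto simp: residue_family_def cyclic_sum_def mod_add_eq)

lemma residue_family_zero: "residue_family I c (\<lambda>i. 0) = \<one>\<^bsub>cyclic_sum I c\<^esub>"
  by (auto simp: residue_family_def cyclic_sum_def)

lemma residue_family_pow:
  fixes n :: nat
  shows "residue_family I c x [^]\<^bsub>cyclic_sum I c\<^esub> n = residue_family I c (\<lambda>i. int n * x i)"
  by (induction n)
    (simp_all add: residue_family_zero residue_family_mult algebra_simps)

lemma residue_family_in_carrier:
  assumes "finite I" "\<forall>i\<in>I. c i > 0"
  shows "residue_family I c x \<in> carrier (cyclic_sum I c)"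
  using residue_family_surj [of I c] assms by blast

text \<open>Reduction is idempotent and every element is some residue family, so an element can
  serve as its own family of integer representatives.\<close>

lemma residue_family_id:
  assumes "finite I" "\<forall>i\<in>I. c i > 0" "u \<in> carrier (cyclic_sum I c)"
  shows "residue_family I c u = u"
proof -
  obtain x where "u = residue_family I c x"
    using residue_family_surj [of I c] assms by blast
  then show ?thesis by (auto simp: residue_family_def)
qed

lemma cyclic_sum_carrier_nonneg:
  assumes "finite I" "\<forall>i\<in>I. c i > 0" "u \<in> carrier (cyclic_sum I c)" "i \<in> I"
  shows "0 \<le> u i"
proof -
  have "0 \<le> residue_family I c u i"
    using assms(2,4) by (simp add: residue_family_def)
  then show ?thesis
    by (simp only: residue_family_id [OF assms(1-3)])
qed

lemma cyclic_basis_in_carrier: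
  assumes "finite I" "\<forall>i\<in>I. c i > 0"
  shows "cyclic_basis I c k \<in> carrier (cyclic_sum I c)"
  unfolding cyclic_basis_def by (rule residue_family_in_carrier [OF assms])

text \<open>Entry \<open>k\<close> becomes a multiple of \<open>c k\<close> and all others stay 0;
  for \<open>k\<close> outside \<open>I\<close> every entry is 0 already.\<close>

lemma cyclic_basis_pow_order: "cyclic_basis I c k [^]\<^bsub>cyclic_sum I c\<^esub> c k = \<one>\<^bsub>cyclic_sum I c\<^esub>"
proof -
  have "residue_family I c (\<lambda>i. int (c k) * of_bool (i = k)) = residue_family I c (\<lambda>i. 0)"
    by (rule residue_family_cong) auto
  then show ?thesis
    by (simp add: cyclic_basis_def residue_family_pow residue_family_zero)
qed

section \<open>Homomorphisms out of a direct sum of cyclic groups\<close>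

text \<open>The basis elements generate: \<open>u\<close> is the product of their powers with
  exponents \<open>u k\<close>, assembled one coordinate at a time.\<close>

lemma cyclic_sum_hom_eqI:
  assumes fin: "finite I" and pos: "\<forall>i\<in>I. c i > 0" and G: "group G"
    and h: "h \<in> hom (cyclic_sum I c) G" and h': "h' \<in> hom (cyclic_sum I c) G"
    and eq: "\<And>k. k \<in> I \<Longrightarrow> h (cyclic_basis I c k) = h' (cyclic_basis I c k)"
    and u: "u \<in> carrier (cyclic_sum I c)"
  shows "h u = h' u"
proof -
  interpret h: group_hom "cyclic_sum I c" G h
    by (simp add: group_hom_def group_hom_axioms_def G h group_cyclic_sum)
  interpret h': group_hom "cyclic_sum I c" G h'
    by (simp add: group_hom_def group_hom_axioms_def G h' group_cyclic_sum)
  note cl = residue_family_in_carrier [of I c, OF fin pos]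
  note bcl = cyclic_basis_in_carrier [of I c, OF fin pos]
  \<comment> \<open>\<open>r S\<close> is \<open>u\<close> with the coordinates outside
    \<open>S\<close> set to zero; the induction runs from the identity \<open>r {}\<close> up to
    \<open>r I = u\<close>.\<close>
  define r where "r S = residue_family I c (\<lambda>i. of_bool (i \<in> S) * u i)" for S
  have "h (r S) = h' (r S)" if "finite S" "S \<subseteq> I" for S
    using that
  proof (induction S rule: finite_induct)
    case empty
    then show ?case by (simp add: r_def residue_family_zero)
  next
    case (insert k S)
    \<comment> \<open>Nonnegative representatives make \<open>nat (u k)\<close> lossless, so natural
      powers of the basis element reach coordinate \<open>k\<close> of \<open>u\<close>.\<close>
    have "0 \<le> u k"
      using cyclic_sum_carrier_nonneg [OF fin pos u] insert.prems by simp
    then have "r (insert k S) =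
        (cyclic_basis I c k [^]\<^bsub>cyclic_sum I c\<^esub> nat (u k)) \<otimes>\<^bsub>cyclic_sum I c\<^esub> r S"
      using insert.hyps
      by (auto simp: r_def cyclic_basis_def residue_family_pow residue_family_mult
          intro!: residue_family_cong)
    moreover have "r S \<in> carrier (cyclic_sum I c)"
      by (simp add: r_def cl)
    ultimately show ?case
      using insert eq [of k] bcl [of k] by (simp add: h.hom_nat_pow h'.hom_nat_pow)
  qed
  from this [OF fin] have "h (r I) = h' (r I)" by simp
  moreover have "r I = residue_family I c u"
    unfolding r_def by (rule residue_family_cong) simp
  then have "r I = u"
    using residue_family_id [OF fin pos u] by simp
  ultimately show ?thesis by simp
qed

text \<open>The map is the product of the powers \<open>t k\<close> to the \<open>z k\<close>. The
  torsion hypothesis makes each power depend only on \<open>z k\<close> modulo \<open>c k\<close>,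
  which is compatible with addition in the summand.\<close>

lemma cyclic_sum_hom_exists:
  assumes fin: "finite I" and "comm_group G"
    and t: "\<And>k. k \<in> I \<Longrightarrow> t k \<in> carrier G"
    and tors: "\<And>k. k \<in> I \<Longrightarrow> t k [^]\<^bsub>G\<^esub> c k = \<one>\<^bsub>G\<^esub>"
  obtains h where "h \<in> hom (cyclic_sum I c) G"
    "\<And>k. k \<in> I \<Longrightarrow> h (cyclic_basis I c k) = t k"
proof -
  interpret G: comm_group G by fact
  have pow_mod: "t k [^]\<^bsub>G\<^esub> (z mod int (c k)) = t k [^]\<^bsub>G\<^esub> z" if "k \<in> I" for k and z :: int
  proof -
    have "t k [^]\<^bsub>G\<^esub> z = t k [^]\<^bsub>G\<^esub> (int (c k) * (z div int (c k)) + z mod int (c k))"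
      by simp
    also have "\<dots> = (t k [^]\<^bsub>G\<^esub> int (c k)) [^]\<^bsub>G\<^esub> (z div int (c k)) \<otimes>\<^bsub>G\<^esub> t k [^]\<^bsub>G\<^esub> (z mod int (c k))"
      using t [OF that] by (simp only: G.int_pow_mult G.int_pow_pow)
    also have "\<dots> = t k [^]\<^bsub>G\<^esub> (z mod int (c k))"
      using t [OF that] tors [OF that] by (simp add: int_pow_int)
    finally show ?thesis by simp
  qed
  define h where "h z = (\<Otimes>\<^bsub>G\<^esub>k\<in>I. t k [^]\<^bsub>G\<^esub> (z k :: int))" for z
  have mult_at: "(x \<otimes>\<^bsub>cyclic_sum I c\<^esub> y) k = (x k + y k) mod int (c k)" if "k \<in> I" for x y k
    using that by (simp add: cyclic_sum_def)
  show thesis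
  proof
    show "h \<in> hom (cyclic_sum I c) G"
    proof (rule homI)
      fix x show "h x \<in> carrier G"
        unfolding h_def using t by (intro G.finprod_closed) auto
    next
      fix x y
      have "h (x \<otimes>\<^bsub>cyclic_sum I c\<^esub> y) = (\<Otimes>\<^bsub>G\<^esub>k\<in>I. t k [^]\<^bsub>G\<^esub> x k \<otimes>\<^bsub>G\<^esub> t k [^]\<^bsub>G\<^esub> y k)"
        unfolding h_def using t
        by (intro G.finprod_cong') (auto simp: mult_at pow_mod G.int_pow_mult)
      also have "\<dots> = h x \<otimes>\<^bsub>G\<^esub> h y"
        unfolding h_def using t by (intro G.finprod_multf) auto
      finally show "h (x \<otimes>\<^bsub>cyclic_sum I c\<^esub> y) = h x \<otimes>\<^bsub>G\<^esub> h y" .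
    qed
  next
    fix k assume k: "k \<in> I"
    \<comment> \<open>By \<open>pow_mod\<close> the exponents may be read as 0 and 1 before
      reduction, which also covers \<open>c k = 1\<close>; only the factor at \<open>k\<close>
      survives.\<close>
    have "h (cyclic_basis I c k) = (\<Otimes>\<^bsub>G\<^esub>i\<in>I. if k = i then t i else \<one>\<^bsub>G\<^esub>)"
      unfolding h_def using t
      by (intro G.finprod_cong')
        (auto simp: cyclic_basis_def residue_family_def pow_mod)
    also have "\<dots> = t k"
      using k fin t by (intro G.finprod_singleton) auto
    finally show "h (cyclic_basis I c k) = t k" .
  qed
qed

section \<open>Bilinear maps: powers, torsion and determination by basis pairs\<close>

lemma bilinear_map_hom_left:
  "bilinear_map A B C f \<Longrightarrow> y \<in> carrier B \<Longrightarrow> (\<lambda>x. f x y) \<in> hom A C"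
  by (auto simp: bilinear_map_def intro!: homI)

lemma bilinear_map_hom_right:
  "bilinear_map A B C f \<Longrightarrow> x \<in> carrier A \<Longrightarrow> f x \<in> hom B C"
  by (auto simp: bilinear_map_def intro!: homI)

lemma bilinear_map_compose_hom:
  "bilinear_map A B C f \<Longrightarrow> h \<in> hom C D \<Longrightarrow> bilinear_map A B D (\<lambda>x y. h (f x y))"
  by (auto simp: bilinear_map_def hom_def Pi_iff)

lemma bilinear_map_pow_left:
  fixes n :: nat
  assumes "bilinear_map A B C f" "group A" "group C" "x \<in> carrier A" "y \<in> carrier B"
  shows "f (x [^]\<^bsub>A\<^esub> n) y = f x y [^]\<^bsub>C\<^esub> n"
proof -
  interpret group_hom A C "\<lambda>x. f x y"
    using assms by (simp add: group_hom_def group_hom_axioms_def bilinear_map_hom_left)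
  show ?thesis using assms(4) by (rule hom_nat_pow)
qed

lemma bilinear_map_pow_right:
  fixes n :: nat
  assumes "bilinear_map A B C f" "group B" "group C" "x \<in> carrier A" "y \<in> carrier B"
  shows "f x (y [^]\<^bsub>B\<^esub> n) = f x y [^]\<^bsub>C\<^esub> n"
proof -
  interpret group_hom B C "f x"
    using assms by (simp add: group_hom_def group_hom_axioms_def bilinear_map_hom_right)
  show ?thesis using assms(5) by (rule hom_nat_pow)
qed

text \<open>Moving an exponent into either argument shows that \<open>f x y\<close> is killed by
  both \<open>p\<close> and \<open>q\<close>. Its order therefore divides both, hence also their
  gcd.\<close>

lemma bilinear_map_torsion:
  fixes p q :: nat
  assumes f: "bilinear_map A B C f" and A: "group A" and B: "group B" and C: "group C"
    and x: "x \<in> carrier A" and y: "y \<in> carrier B"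
    and p: "x [^]\<^bsub>A\<^esub> p = \<one>\<^bsub>A\<^esub>" and q: "y [^]\<^bsub>B\<^esub> q = \<one>\<^bsub>B\<^esub>"
  shows "f x y [^]\<^bsub>C\<^esub> gcd p q = \<one>\<^bsub>C\<^esub>"
proof -
  interpret C: group C by fact
  have fxy: "f x y \<in> carrier C"
    using f x y by (simp add: bilinear_map_def)
  have "f \<one>\<^bsub>A\<^esub> y = \<one>\<^bsub>C\<^esub>" "f x \<one>\<^bsub>B\<^esub> = \<one>\<^bsub>C\<^esub>"
    using hom_one [OF bilinear_map_hom_left [OF f y] A C]
      hom_one [OF bilinear_map_hom_right [OF f x] B C] .
  then have "f x y [^]\<^bsub>C\<^esub> p = \<one>\<^bsub>C\<^esub>" "f x y [^]\<^bsub>C\<^esub> q = \<one>\<^bsub>C\<^esub>"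
    using bilinear_map_pow_left [OF f A C x y, of p] bilinear_map_pow_right [OF f B C x y, of q] p q
    by simp_all
  then show ?thesis
    using fxy by (simp add: C.pow_eq_id)
qed

text \<open>Uniqueness of homomorphisms is applied twice: first in the left argument with
  \<open>v\<close> fixed, then in the right argument with a basis element on the left.\<close>

lemma bilinear_map_cyclic_sum_eqI:
  assumes I: "finite I" "\<forall>i\<in>I. a i > 0" and J: "finite J" "\<forall>j\<in>J. b j > 0"
    and C: "group C"
    and f: "bilinear_map (cyclic_sum I a) (cyclic_sum J b) C f"
    and g: "bilinear_map (cyclic_sum I a) (cyclic_sum J b) C g"
    and eq: "\<And>i j. \<lbrakk>i \<in> I; j \<in> J\<rbrakk> \<Longrightarrow>
      f (cyclic_basis I a i) (cyclic_basis J b j) = g (cyclic_basis I a i) (cyclic_basis J b j)"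
    and u: "u \<in> carrier (cyclic_sum I a)" and v: "v \<in> carrier (cyclic_sum J b)"
  shows "f u v = g u v"
proof (rule cyclic_sum_hom_eqI [OF I C, where u = u])
  show "(\<lambda>u. f u v) \<in> hom (cyclic_sum I a) C" "(\<lambda>u. g u v) \<in> hom (cyclic_sum I a) C"
    using f g v by (simp_all add: bilinear_map_hom_left)
next
  fix i assume i: "i \<in> I"
  have e: "cyclic_basis I a i \<in> carrier (cyclic_sum I a)"
    by (rule cyclic_basis_in_carrier [OF I])
  show "f (cyclic_basis I a i) v = g (cyclic_basis I a i) v"
    by (rule cyclic_sum_hom_eqI [OF J C bilinear_map_hom_right [OF f e]
          bilinear_map_hom_right [OF g e] eq [OF i] v])
qed (use u in auto)

section \<open>The bilinear map of coordinatewise products\<close>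

text \<open>The product is taken on group elements, that is on least residues, so it is a function
  without any choice; the formula for arbitrary representatives is a separate fact.\<close>

definition residue_product ::
  "'i set \<Rightarrow> 'j set \<Rightarrow> ('i \<Rightarrow> nat) \<Rightarrow> ('j \<Rightarrow> nat) \<Rightarrow> ('i \<Rightarrow> int) \<Rightarrow> ('j \<Rightarrow> int) \<Rightarrow> 'i \<times> 'j \<Rightarrow> int"
  where "residue_product I J a b u v =
    residue_family (I \<times> J) (\<lambda>(i, j). gcd (a i) (b j)) (\<lambda>(i, j). u i * v j)"

text \<open>Independence of representatives: \<open>gcd (a i) (b j)\<close> divides both moduli, so
  reducing the factors first does not change the product modulo the gcd.\<close>

lemma residue_product_residue_family:
  "residue_product I J a b (residue_family I a x) (residue_family J b y) =
    residue_family (I \<times> J) (\<lambda>(i, j). gcd (a i) (b j)) (\<lambda>(i, j). x i * y j)"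
  unfolding residue_product_def
proof (rule residue_family_cong)
  fix k assume "k \<in> I \<times> J"
  then obtain i j where k: "k = (i, j)" and ij: "i \<in> I" "j \<in> J"
    by blast
  have "(x i mod int (a i)) * (y j mod int (b j)) mod int (gcd (a i) (b j)) =
      x i * y j mod int (gcd (a i) (b j))"
    by (intro mod_mult_cong mod_mod_cancel) simp_all
  then show "(case k of (i, j) \<Rightarrow> residue_family I a x i * residue_family J b y j)
        mod int (case k of (i, j) \<Rightarrow> gcd (a i) (b j)) =
      (case k of (i, j) \<Rightarrow> x i * y j) mod int (case k of (i, j) \<Rightarrow> gcd (a i) (b j))"
    using k ij by (simp add: residue_family_def)
qed

text \<open>The product of the indicators of \<open>i\<close> and \<open>j\<close> is the indicator
  of the pair \<open>(i, j)\<close>.\<close>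

lemma residue_product_basis:
  assumes "i \<in> I" "j \<in> J"
  shows "residue_product I J a b (cyclic_basis I a i) (cyclic_basis J b j) =
    cyclic_basis (I \<times> J) (\<lambda>(i, j). gcd (a i) (b j)) (i, j)"
  unfolding cyclic_basis_def residue_product_residue_family
  by (rule arg_cong [of _ _ "residue_family _ _"]) (auto simp: fun_eq_iff)

lemma bilinear_residue_product:
  assumes I: "finite I" "\<forall>i\<in>I. a i > 0" and J: "finite J" "\<forall>j\<in>J. b j > 0"
  shows "bilinear_map (cyclic_sum I a) (cyclic_sum J b)
    (cyclic_sum (I \<times> J) (\<lambda>(i, j). gcd (a i) (b j))) (residue_product I J a b)"
proof -
  let ?d = "\<lambda>(i, j). gcd (a i) (b j)"
  have cl: "residue_family (I \<times> J) ?d z \<in> carrier (cyclic_sum (I \<times> J) ?d)" for z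
    using I J by (intro residue_family_in_carrier) auto
  show ?thesis
    unfolding bilinear_map_def
  proof (intro conjI ballI)
    fix u v show "residue_product I J a b u v \<in> carrier (cyclic_sum (I \<times> J) ?d)"
      unfolding residue_product_def by (rule cl)
  next
    fix u u' v
    assume "u \<in> carrier (cyclic_sum I a)" "u' \<in> carrier (cyclic_sum I a)" "v \<in> carrier (cyclic_sum J b)"
    \<comment> \<open>With every element written as a residue family, both sides become residue
      families of integer expressions, and additivity reduces to distributivity.\<close>
    then obtain x x' y where
      "u = residue_family I a x" "u' = residue_family I a x'" "v = residue_family J b y"
      using residue_family_id [OF I] residue_family_id [OF J] by metis
    then show "residue_product I J a b (u \<otimes>\<^bsub>cyclic_sum I a\<^esub> u') v =
        residue_product I J a b u v \<otimes>\<^bsub>cyclic_sum (I \<times> J) ?d\<^esub> residue_product I J a b u' v"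
      by (simp add: residue_product_residue_family residue_family_mult)
        (rule residue_family_cong, simp add: case_prod_unfold algebra_simps)
  next
    fix u v v'
    assume "u \<in> carrier (cyclic_sum I a)" "v \<in> carrier (cyclic_sum J b)" "v' \<in> carrier (cyclic_sum J b)"
    then obtain x y y' where
      "u = residue_family I a x" "v = residue_family J b y" "v' = residue_family J b y'"
      using residue_family_id [OF I] residue_family_id [OF J] by metis
    then show "residue_product I J a b u (v \<otimes>\<^bsub>cyclic_sum J b\<^esub> v') =
        residue_product I J a b u v \<otimes>\<^bsub>cyclic_sum (I \<times> J) ?d\<^esub> residue_product I J a b u v'"
      by (simp add: residue_product_residue_family residue_family_mult)
        (rule residue_family_cong, simp add: case_prod_unfold algebra_simps)
  qed
qed

section \<open>The isomorphism and its inverse\<close>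

lemma tensor_cyclic_sum_iso:
  fixes I :: "'i set" and J :: "'j set"
  assumes I: "finite I" "\<forall>i\<in>I. a i > 0" and J: "finite J" "\<forall>j\<in>J. b j > 0"
  obtains \<phi> where
    "\<phi> \<in> iso (tensor_group (cyclic_sum I a) (cyclic_sum J b))
      (cyclic_sum (I \<times> J) (\<lambda>(i, j). gcd (a i) (b j)))"
    "\<And>u v. \<lbrakk>u \<in> carrier (cyclic_sum I a); v \<in> carrier (cyclic_sum J b)\<rbrakk> \<Longrightarrow>
      \<phi> (elem_tensor (cyclic_sum I a) (cyclic_sum J b) u v) = residue_product I J a b u v"
proof -
  let ?A = "cyclic_sum I a" and ?B = "cyclic_sum J b"
  let ?K = "I \<times> J" and ?d = "\<lambda>(i, j). gcd (a i) (b j)"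
  let ?C = "cyclic_sum ?K ?d"
  let ?T = "tensor_group ?A ?B" and ?t = "elem_tensor ?A ?B"
  let ?e = "cyclic_basis I a" and ?f = "cyclic_basis J b"
  note mon = monoid_cyclic_sum [of I a] monoid_cyclic_sum [of J b]
  have K: "finite ?K" "\<forall>k\<in>?K. ?d k > 0"
    using I J by auto
  have e: "?e i \<in> carrier ?A" and f: "?f j \<in> carrier ?B" for i j
    using cyclic_basis_in_carrier [OF I] cyclic_basis_in_carrier [OF J] by auto
  interpret T: comm_group ?T by (rule comm_group_tensor_group [OF mon])
  have bt: "bilinear_map ?A ?B ?T ?t" by (rule bilinear_elem_tensor [OF mon])
  obtain \<phi> where \<phi>: "\<phi> \<in> hom ?T ?C"
    and \<phi>t: "\<And>u v. \<lbrakk>u \<in> carrier ?A; v \<in> carrier ?B\<rbrakk> \<Longrightarrow> \<phi> (?t u v) = residue_product I J a b u v"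
    using tensor_group_universal [OF mon comm_group_cyclic_sum bilinear_residue_product [OF I J]]
    by blast
  have tors: "?t (?e i) (?f j) [^]\<^bsub>?T\<^esub> gcd (a i) (b j) = \<one>\<^bsub>?T\<^esub>" for i j
    by (rule bilinear_map_torsion [OF bt group_cyclic_sum group_cyclic_sum T.is_group e f
          cyclic_basis_pow_order cyclic_basis_pow_order])
  \<comment> \<open>\<gamma> is the candidate inverse; \<open>tors\<close> supplies exactly the
    torsion condition needed to prescribe its values on the basis.\<close>
  obtain \<gamma> where \<gamma>: "\<gamma> \<in> hom ?C ?T"
    and \<gamma>b: "\<And>k. k \<in> ?K \<Longrightarrow> \<gamma> (cyclic_basis ?K ?d k) = (case k of (i, j) \<Rightarrow> ?t (?e i) (?f j))"
  proof (rule cyclic_sum_hom_exists [OF K(1) T.comm_group_axioms, where t = "\<lambda>(i, j). ?t (?e i) (?f j)"])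
    fix k assume "k \<in> ?K"
    show "(case k of (i, j) \<Rightarrow> ?t (?e i) (?f j)) \<in> carrier ?T"
      using bt e f by (auto simp: bilinear_map_def split: prod.split)
    show "(case k of (i, j) \<Rightarrow> ?t (?e i) (?f j)) [^]\<^bsub>?T\<^esub> ?d k = \<one>\<^bsub>?T\<^esub>"
      using tors by (simp split: prod.split)
  qed (rule that)
  have \<phi>\<gamma>: "\<phi> (\<gamma> z) = z" if "z \<in> carrier ?C" for z
  proof (rule cyclic_sum_hom_eqI [OF K group_cyclic_sum, where h = "\<lambda>z. \<phi> (\<gamma> z)" and h' = "\<lambda>z. z"])
    show "(\<lambda>z. \<phi> (\<gamma> z)) \<in> hom ?C ?C"
      using hom_compose [OF \<gamma> \<phi>] by (simp add: comp_def)
    show "(\<lambda>z. z) \<in> hom ?C ?C" by (simp add: hom_def)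
    show "\<phi> (\<gamma> (cyclic_basis ?K ?d k)) = cyclic_basis ?K ?d k" if "k \<in> ?K" for k
      using that e f by (auto simp: \<gamma>b \<phi>t residue_product_basis)
  qed (use that in auto)
  \<comment> \<open>Both sides are bilinear in \<open>u\<close> and \<open>v\<close>, so it suffices
    to compare them on pairs of basis elements, where \<phi> gives a basis element and \<gamma>
    sends it back.\<close>
  have \<gamma>\<phi>t: "\<gamma> (\<phi> (?t u v)) = ?t u v" if u: "u \<in> carrier ?A" and v: "v \<in> carrier ?B" for u v
  proof (rule bilinear_map_cyclic_sum_eqI [OF I J T.is_group _ bt _ u v])
    show "bilinear_map ?A ?B ?T (\<lambda>u v. \<gamma> (\<phi> (?t u v)))"
      by (intro bilinear_map_compose_hom [OF _ \<gamma>] bilinear_map_compose_hom [OF bt \<phi>])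
    show "\<gamma> (\<phi> (?t (?e i) (?f j))) = ?t (?e i) (?f j)" if "i \<in> I" "j \<in> J" for i j
      using that e f by (simp add: \<gamma>b \<phi>t residue_product_basis)
  qed
  \<comment> \<open>The composite and the identity are homomorphisms that agree on elementary
    tensors, hence on the whole tensor product.\<close>
  have \<gamma>\<phi>: "\<gamma> (\<phi> t) = t" if "t \<in> carrier ?T" for t
  proof (rule tensor_group_hom_unique [OF mon T.is_group, where g = "\<lambda>t. \<gamma> (\<phi> t)" and g' = "\<lambda>t. t"])
    show "(\<lambda>t. \<gamma> (\<phi> t)) \<in> hom ?T ?T"
      using hom_compose [OF \<phi> \<gamma>] by (simp add: comp_def)
    show "(\<lambda>t. t) \<in> hom ?T ?T" by (simp add: hom_def)
  qed (use that \<gamma>\<phi>t in auto)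
  have "group_isomorphisms ?T ?C \<phi> \<gamma>"
    using \<phi> \<gamma> \<phi>\<gamma> \<gamma>\<phi> by (simp add: group_isomorphisms_def)
  then show thesis
    using that \<phi>t group_isomorphisms_imp_iso by blast
qed

theorem lemma6:
  fixes a b :: "nat \<Rightarrow> nat" and m n :: nat
  assumes a_pos: "\<And>i. i \<in> {1..m} \<Longrightarrow> a i > 0"
    and b_pos: "\<And>j. j \<in> {1..n} \<Longrightarrow> b j > 0"
  shows
    "let I = {1..m}; J = {1..n}; d = (\<lambda>(i, j). gcd (a i) (b j));
         A = cyclic_sum I a; B = cyclic_sum J b; C = cyclic_sum (I \<times> J) d;
         on_elementary = (\<lambda>\<phi>. \<forall>x y :: nat \<Rightarrow> int.
           \<phi> (elem_tensor A B (residue_family I a x) (residue_family J b y)) =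
             residue_family (I \<times> J) d (\<lambda>(i, j). x i * y j))
     in \<exists>\<phi> \<in> iso (tensor_group A B) C.
          on_elementary \<phi> \<and>
          (\<forall>\<psi> \<in> hom (tensor_group A B) C.
             on_elementary \<psi> \<longrightarrow> (\<forall>t \<in> carrier (tensor_group A B). \<psi> t = \<phi> t)) \<and>
          (\<exists>\<beta>. bilinear_map A B C \<beta> \<and>
               (\<forall>u \<in> carrier A. \<forall>v \<in> carrier B. \<phi> (elem_tensor A B u v) = \<beta> u v) \<and>
               (\<forall>x y :: nat \<Rightarrow> int.
                  \<beta> (residue_family I a x) (residue_family J b y) =
                    residue_family (I \<times> J) d (\<lambda>(i, j). x i * y j)))"
proof -
  let ?I = "{1..m}" and ?J = "{1..n}" and ?d = "\<lambda>(i, j). gcd (a i) (b j)"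
  let ?A = "cyclic_sum ?I a" and ?B = "cyclic_sum ?J b" and ?C = "cyclic_sum (?I \<times> ?J) ?d"
  let ?T = "tensor_group ?A ?B" and ?t = "elem_tensor ?A ?B"
  let ?r = "residue_family ?I a" and ?s = "residue_family ?J b"
  let ?p = "residue_product ?I ?J a b"
  let ?on = "\<lambda>\<phi>. \<forall>x y. \<phi> (?t (?r x) (?s y)) = residue_family (?I \<times> ?J) ?d (\<lambda>(i, j). x i * y j)"
  have I: "finite ?I" "\<forall>i\<in>?I. a i > 0" and J: "finite ?J" "\<forall>j\<in>?J. b j > 0"
    using a_pos b_pos by auto
  obtain \<phi> where \<phi>: "\<phi> \<in> iso ?T ?C"
    and \<phi>t: "\<And>u v. \<lbrakk>u \<in> carrier ?A; v \<in> carrier ?B\<rbrakk> \<Longrightarrow> \<phi> (?t u v) = ?p u v"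
    by (rule tensor_cyclic_sum_iso [OF I J]) (rule that)
  have on: "?on \<phi>"
    by (simp only: \<phi>t residue_family_in_carrier [OF I] residue_family_in_carrier [OF J]
        residue_product_residue_family) simp
  \<comment> \<open>The condition on \<psi> concerns residue families only; as each \<open>u\<close>
    and \<open>v\<close> is its own residue family, it covers all elementary tensors.\<close>
  have uniq: "\<psi> t = \<phi> t" if \<psi>: "\<psi> \<in> hom ?T ?C" "?on \<psi>" and t: "t \<in> carrier ?T" for \<psi> t
  proof (rule tensor_group_hom_unique [OF monoid_cyclic_sum monoid_cyclic_sum group_cyclic_sum])
    show "\<psi> \<in> hom ?T ?C" by fact
    show "\<phi> \<in> hom ?T ?C" using \<phi> by (simp add: iso_def)
    show "\<psi> (?t u v) = \<phi> (?t u v)" if "u \<in> carrier ?A" "v \<in> carrier ?B" for u v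
      using \<psi>(2) on residue_family_id [OF I that(1)] residue_family_id [OF J that(2)] by metis
    show "t \<in> carrier ?T" by fact
  qed
  \<comment> \<open>The witness for \<beta> is \<open>residue_product\<close>, the canonical
    bilinear map transported along \<phi>.\<close>
  have "bilinear_map ?A ?B ?C ?p"
    by (rule bilinear_residue_product [OF I J])
  with \<phi> \<phi>t on uniq residue_product_residue_family show ?thesis
    unfolding Let_def by (intro bexI [of _ \<phi>] conjI exI [of _ ?p]) auto
qed

end
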